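(* Let $\mathscr{A}=(\mathscr{A},f,g)$ be a commutative Krasner $(m,n)$-hyperring with scalar identity $1_{\mathscr{A}}$ and let $P$ be a proper hyperideal of $\mathscr{A}$. Let $S$ be the set of all $x\in\mathscr{A}$ such that, for every $1\le i\le n$ and all $p_1^{i-1},p_{i+1}^n\in\mathscr{A}$, $g(p_1^{i-1},x,p_{i+1}^n)\in P$ implies $g(p_1^{i-1},1_{\mathscr{A}},p_{i+1}^n)\in P$. Then $S$ is an $n$-ary multiplicative subset of $\mathscr{A}$, $P$ is an $n$-ary $S$-hyperideal of $\mathscr{A}$, and $S$ is maximal with this property: if $S'\supseteq S$ is an $n$-ary multiplicative subset of $\mathscr{A}$ such that $P$ is an $n$-ary $S'$-hyperideal, then $S'=S$.
   Context: Let $m,n\ge 2$. Notation: $p_i^j$ denotes the sequence $p_i,\dots,p_j$ (empty if $j<i$); $p^{(k)}$ denotes $p$ repeated $k$ times; for non-empty subsets, $f(P_1^m)=\bigcup\{f(p_1^m)\mid p_i\in P_i\}$ and similarly for $g$; singletons are identified with elements. A canonical $m$-ary hypergroup $(\mathscr{A},f)$ is a set with $f:\mathscr{A}^m\to\{\text{non-empty subsets of }\mathscr{A}\}$ such that: $f$ is associative ($f(p_1^{i-1},f(p_i^{m+i-1}),p_{m+i}^{2m-1})$ is independent of $i$) and invariant under permutations of its arguments; there is a unique $0$ with $f(p,0^{(m-1)})=\{p\}$ for all $p$; each $p$ has a unique $-p$ with $0\in f(p,-p,0^{(m-2)})$; and $p\in f(p_1^m)$ implies $p_i\in f(p,-p_1,\dots,-p_{i-1},-p_{i+1},\dots,-p_m)$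 for each $i$. A commutative Krasner $(m,n)$-hyperring with scalar identity $1_{\mathscr{A}}$ is $(\mathscr{A},f,g)$ with $(\mathscr{A},f)$ a canonical $m$-ary hypergroup, $g:\mathscr{A}^n\to\mathscr{A}$ an associative operation invariant under permutations of its arguments, $g$ distributive over $f$ in each argument ($g(p_1^{i-1},f(q_1^m),p_{i+1}^n)=f(g(p_1^{i-1},q_1,p_{i+1}^n),\dots,g(p_1^{i-1},q_m,p_{i+1}^n))$), $g(0,p_2^n)=0$, and $g(p,1_{\mathscr{A}}^{(n-1)})=p$ for all $p$. A hyperideal is a non-empty $P\subseteq\mathscr{A}$ with $f(p_1^m)\subseteq P$ and $-p\in P$ for all $p,p_1,\dots,p_m\in P$, and $g(p_1^{i-1},P,p_{i+1}^n)\subseteq P$ for all $p_j\in\mathscr{A}$ and all $i$; it is proper if $P\ne\mathscr{A}$. An $n$-ary multiplicative subset is a non-empty $S\subseteq\mathscr{A}$ with $g(s_1^n)\in S$ for all $s_1,\dots,s_n\in S$. Given such $S$, an $n$-ary $S$-hyperideal is a proper hyperideal $P$ such that whenever $g(p_1^n)\in P$ with $p_1,\dots,p_n\in\mathscr{A}$ and $p_i\in S$ for some $i$, then $g(p_1^{i-1},1_{\mathscr{A}},p_{i+1}^n)\in P$. *)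

theory Defs
  imports "HOL-Library.Multiset" "HOL-Library.NList"
begin

text \<open>
  A \<open>k\<close>-tuple over \<open>A\<close> is a list in \<open>nlists k A\<close>, and a \<open>k\<close>-ary (hyper)operation is a function on
  lists, constrained only on \<open>nlists k A\<close>. The sequences \<open>p\<^sub>1, \<dots>, p\<^sub>i\<^sub>-\<^sub>1\<close> and \<open>p\<^sub>i\<^sub>+\<^sub>1, \<dots>, p\<^sub>k\<close> around
  the \<open>i\<close>-th argument are lists \<open>ps \<in> nlists (i - 1) A\<close> and \<open>qs \<in> nlists (k - i) A\<close>.
\<close>

definition hyper_ext :: "('a list \<Rightarrow> 'a set) \<Rightarrow> 'a set list \<Rightarrow> 'a set" where
  "hyper_ext f Ps = (\<Union>ps\<in>listset Ps. f ps)"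

definition op_ext :: "('a list \<Rightarrow> 'a) \<Rightarrow> 'a set list \<Rightarrow> 'a set" where
  "op_ext g Ps = g ` listset Ps"

abbreviation singletons :: "'a list \<Rightarrow> 'a set list" where
  "singletons ps \<equiv> map (\<lambda>p. {p}) ps"

definition is_hzero :: "nat \<Rightarrow> 'a set \<Rightarrow> ('a list \<Rightarrow> 'a set) \<Rightarrow> 'a \<Rightarrow> bool" where
  "is_hzero m A f z \<longleftrightarrow> z \<in> A \<and> (\<forall>p\<in>A. f (p # replicate (m - 1) z) = {p})"

definition hzero :: "nat \<Rightarrow> 'a set \<Rightarrow> ('a list \<Rightarrow> 'a set) \<Rightarrow> 'a" where
  "hzero m A f = (THE z. is_hzero m A f z)"

definition is_hneg :: "nat \<Rightarrow> 'a set \<Rightarrow> ('a list \<Rightarrow> 'a set) \<Rightarrow> 'a \<Rightarrow> 'a \<Rightarrow> bool" where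
  "is_hneg m A f p q \<longleftrightarrow>
     q \<in> A \<and> hzero m A f \<in> f (p # q # replicate (m - 2) (hzero m A f))"

definition hneg :: "nat \<Rightarrow> 'a set \<Rightarrow> ('a list \<Rightarrow> 'a set) \<Rightarrow> 'a \<Rightarrow> 'a" where
  "hneg m A f p = (THE q. is_hneg m A f p q)"

locale canonical_hypergroup =
  fixes m :: nat and A :: "'a set" and f :: "'a list \<Rightarrow> 'a set"
  assumes m_ge_2: "2 \<le> m"
    and f_closed: "ps \<in> nlists m A \<Longrightarrow> f ps \<subseteq> A"
    and f_nonempty: "ps \<in> nlists m A \<Longrightarrow> f ps \<noteq> {}"
    and f_assoc: "\<lbrakk>ps \<in> nlists (2 * m - 1) A; i < m; j < m\<rbrakk> \<Longrightarrow>
      hyper_ext f (singletons (take i ps) @ [f (take m (drop i ps))] @ singletons (drop (i + m) ps)) =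
      hyper_ext f (singletons (take j ps) @ [f (take m (drop j ps))] @ singletons (drop (j + m) ps))"
    and f_perm: "\<lbrakk>ps \<in> nlists m A; mset qs = mset ps\<rbrakk> \<Longrightarrow> f qs = f ps"
    and ex1_hzero: "\<exists>!z. is_hzero m A f z"
    and ex1_hneg: "p \<in> A \<Longrightarrow> \<exists>!q. is_hneg m A f p q"
    and f_reversible: "\<lbrakk>i \<in> {1..m}; ps \<in> nlists (i - 1) A; q \<in> A; qs \<in> nlists (m - i) A;
      p \<in> f (ps @ q # qs)\<rbrakk> \<Longrightarrow> q \<in> f (p # map (hneg m A f) (ps @ qs))"

locale krasner_hyperring = canonical_hypergroup m A f
  for m n :: nat and A :: "'a set" and f :: "'a list \<Rightarrow> 'a set" +
  fixes g :: "'a list \<Rightarrow> 'a" and e :: 'a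
  assumes n_ge_2: "2 \<le> n"
    and g_closed: "ps \<in> nlists n A \<Longrightarrow> g ps \<in> A"
    and g_assoc: "\<lbrakk>ps \<in> nlists (2 * n - 1) A; i < n; j < n\<rbrakk> \<Longrightarrow>
      g (take i ps @ [g (take n (drop i ps))] @ drop (i + n) ps) =
      g (take j ps @ [g (take n (drop j ps))] @ drop (j + n) ps)"
    and g_perm: "\<lbrakk>ps \<in> nlists n A; mset qs = mset ps\<rbrakk> \<Longrightarrow> g qs = g ps"
    and g_distrib: "\<lbrakk>i \<in> {1..n}; ps \<in> nlists (i - 1) A; qs \<in> nlists (n - i) A; rs \<in> nlists m A\<rbrakk> \<Longrightarrow>
      op_ext g (singletons ps @ [f rs] @ singletons qs) = f (map (\<lambda>r. g (ps @ r # qs)) rs)"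
    and g_zero: "ps \<in> nlists (n - 1) A \<Longrightarrow> g (hzero m A f # ps) = hzero m A f"
    and e_closed: "e \<in> A"
    and g_one: "p \<in> A \<Longrightarrow> g (p # replicate (n - 1) e) = p"

definition hyperideal ::
  "nat \<Rightarrow> nat \<Rightarrow> 'a set \<Rightarrow> ('a list \<Rightarrow> 'a set) \<Rightarrow> ('a list \<Rightarrow> 'a) \<Rightarrow> 'a set \<Rightarrow> bool" where
  "hyperideal m n A f g P \<longleftrightarrow>
     P \<noteq> {} \<and> P \<subseteq> A \<and>
     (\<forall>ps\<in>nlists m P. f ps \<subseteq> P) \<and>
     (\<forall>p\<in>P. hneg m A f p \<in> P) \<and>
     (\<forall>i\<in>{1..n}. \<forall>ps\<in>nlists (i - 1) A. \<forall>qs\<in>nlists (n - i) A.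
        op_ext g (singletons ps @ [P] @ singletons qs) \<subseteq> P)"

definition proper_hyperideal ::
  "nat \<Rightarrow> nat \<Rightarrow> 'a set \<Rightarrow> ('a list \<Rightarrow> 'a set) \<Rightarrow> ('a list \<Rightarrow> 'a) \<Rightarrow> 'a set \<Rightarrow> bool" where
  "proper_hyperideal m n A f g P \<longleftrightarrow> hyperideal m n A f g P \<and> P \<noteq> A"

definition multiplicative_subset :: "nat \<Rightarrow> 'a set \<Rightarrow> ('a list \<Rightarrow> 'a) \<Rightarrow> 'a set \<Rightarrow> bool" where
  "multiplicative_subset n A g S \<longleftrightarrow> S \<noteq> {} \<and> S \<subseteq> A \<and> (\<forall>ss\<in>nlists n S. g ss \<in> S)"

text \<open>The \<open>i\<close>-th entry of a tuple \<open>ps\<close> is \<open>ps ! (i - 1)\<close>, as list positions start at \<open>0\<close>.\<close>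

definition S_hyperideal ::
  "nat \<Rightarrow> nat \<Rightarrow> 'a set \<Rightarrow> ('a list \<Rightarrow> 'a set) \<Rightarrow> ('a list \<Rightarrow> 'a) \<Rightarrow> 'a \<Rightarrow> 'a set \<Rightarrow> 'a set \<Rightarrow> bool" where
  "S_hyperideal m n A f g e S P \<longleftrightarrow>
     proper_hyperideal m n A f g P \<and>
     (\<forall>ps\<in>nlists n A. \<forall>i\<in>{1..n}.
        g ps \<in> P \<and> ps ! (i - 1) \<in> S \<longrightarrow> g (ps[i - 1 := e]) \<in> P)"

end

theory Submission
  imports Defs
begin

text \<open>
  By commutativity, \<open>x \<in> S\<close> only has to be tested with \<open>x\<close> as the first argument. Given
  \<open>g(g(s\<^sub>1,\<dots>,s\<^sub>n),q\<^sub>2,\<dots>,q\<^sub>n) \<in> P\<close> with all \<open>s\<^sub>i \<in> S\<close>, commutativity and associativity bring any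
  \<open>s\<^sub>i\<close> to the outer first position, where it may be replaced by the identity \<open>e\<close>. Doing this for
  every \<open>s\<^sub>i\<close> turns the inner product into \<open>g(e,\<dots>,e) = e\<close>. Maximality holds because \<open>P\<close> being an
  \<open>S'\<close>-hyperideal says precisely that every element of \<open>S'\<close> satisfies the condition defining \<open>S\<close>.
\<close>

text \<open>As simp rules, these loop in combination with \<open>nlists_def\<close>.\<close>

declare nlistsE_length [simp del] nlistsE_set [simp del]

definition cancellable_set :: "nat \<Rightarrow> 'a set \<Rightarrow> ('a list \<Rightarrow> 'a) \<Rightarrow> 'a \<Rightarrow> 'a set \<Rightarrow> 'a set" where
  "cancellable_set n A g e P = {x \<in> A. \<forall>i\<in>{1..n}. \<forall>ps\<in>nlists (i - 1) A. \<forall>qs\<in>nlists (n - i) A.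
     g (ps @ x # qs) \<in> P \<longrightarrow> g (ps @ e # qs) \<in> P}"

text \<open>Splitting a tuple at position \<open>i - 1\<close> turns the entry update of
  \<open>S_hyperideal\<close> into the replacement of \<open>x\<close> by \<open>e\<close> in
  \<open>ps @ x # qs\<close>. This yields both the hyperideal claim and maximality.\<close>

lemma S_hyperideal_iff_subset_cancellable_set:
  assumes "S \<subseteq> A"
  shows "S_hyperideal m n A f g e S P \<longleftrightarrow>
    proper_hyperideal m n A f g P \<and> S \<subseteq> cancellable_set n A g e P"
proof (intro iffI conjI subsetI)
  assume H: "S_hyperideal m n A f g e S P"
  then show "proper_hyperideal m n A f g P"
    by (simp add: S_hyperideal_def)
  fix x assume x: "x \<in> S"
  have "g (ps @ e # qs) \<in> P"
    if i: "i \<in> {1..n}" and ps: "ps \<in> nlists (i - 1) A" and qs: "qs \<in> nlists (n - i) A"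
      and P: "g (ps @ x # qs) \<in> P" for i ps qs
  proof -
    have len: "length ps = i - 1"
      using ps by (simp add: nlists_def)
    have "ps @ x # qs \<in> nlists n A"
      using i ps qs x assms by (auto simp: nlists_def)
    moreover have "(ps @ x # qs) ! (i - 1) \<in> S"
      using x len by (simp add: nth_append)
    ultimately have "g ((ps @ x # qs)[i - 1 := e]) \<in> P"
      using H i P by (simp add: S_hyperideal_def)
    then show ?thesis
      using len by (simp add: list_update_append)
  qed
  with x assms show "x \<in> cancellable_set n A g e P"
    unfolding cancellable_set_def by blast
next
  assume H: "proper_hyperideal m n A f g P \<and> S \<subseteq> cancellable_set n A g e P"
  have "g (ps[i - 1 := e]) \<in> P"
    if ps: "ps \<in> nlists n A" and i: "i \<in> {1..n}" and P: "g ps \<in> P" and S: "ps ! (i - 1) \<in> S"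
    for ps i
  proof -
    have lt: "i - 1 < length ps"
      using ps i by (auto simp: nlists_def)
    \<comment> \<open>As \<open>1 \<le> i\<close>, the truncated subtraction is exact, so the
      entries after position \<open>i - 1\<close> are \<open>drop i ps\<close>.\<close>
    have Suc: "Suc (i - 1) = i"
      using i by simp
    have split: "ps = take (i - 1) ps @ ps ! (i - 1) # drop i ps"
      using id_take_nth_drop[OF lt] Suc by simp
    have "take (i - 1) ps \<in> nlists (i - 1) A" "drop i ps \<in> nlists (n - i) A"
      using ps lt by (auto simp: nlists_def dest: in_set_takeD in_set_dropD)
    moreover have "ps ! (i - 1) \<in> cancellable_set n A g e P"
      using H S by blast
    moreover have "g (take (i - 1) ps @ ps ! (i - 1) # drop i ps) \<in> P"
      using P by (simp only: split [symmetric])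
    ultimately have "g (take (i - 1) ps @ e # drop i ps) \<in> P"
      using i by (simp add: cancellable_set_def)
    then show ?thesis
      using upd_conv_take_nth_drop[OF lt] Suc by simp
  qed
  then show "S_hyperideal m n A f g e S P"
    using H by (simp add: S_hyperideal_def)
qed

context krasner_hyperring
begin

lemma cancellable_set_iff:
  "x \<in> cancellable_set n A g e P \<longleftrightarrow>
    x \<in> A \<and> (\<forall>qs\<in>nlists (n - 1) A. g (x # qs) \<in> P \<longrightarrow> g (e # qs) \<in> P)"
proof (intro iffI conjI ballI impI)
  assume "x \<in> cancellable_set n A g e P"
  then have x: "x \<in> A" and H: "\<And>i ps qs. \<lbrakk>i \<in> {1..n}; ps \<in> nlists (i - 1) A;
      qs \<in> nlists (n - i) A; g (ps @ x # qs) \<in> P\<rbrakk> \<Longrightarrow> g (ps @ e # qs) \<in> P"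
    unfolding cancellable_set_def by blast+
  show "x \<in> A" by (fact x)
  fix qs assume "qs \<in> nlists (n - 1) A" "g (x # qs) \<in> P"
  then show "g (e # qs) \<in> P"
    using H[of 1 "[]" qs] n_ge_2 by (simp add: nlists_def)
next
  assume H: "x \<in> A \<and> (\<forall>qs\<in>nlists (n - 1) A. g (x # qs) \<in> P \<longrightarrow> g (e # qs) \<in> P)"
  have "g (ps @ e # qs) \<in> P"
    if i: "i \<in> {1..n}" and ps: "ps \<in> nlists (i - 1) A" and qs: "qs \<in> nlists (n - i) A"
      and P: "g (ps @ x # qs) \<in> P" for i ps qs
  proof -
    \<comment> \<open>Needed for \<open>y = x\<close> to bring the hypothesis into first-position
      form, and for \<open>y = e\<close> to move the conclusion back.\<close>
    have front: "g (ps @ y # qs) = g (y # ps @ qs)" if "y \<in> A" for y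
      by (rule g_perm) (use i ps qs that in \<open>auto simp: nlists_def\<close>)
    have "ps @ qs \<in> nlists (n - 1) A"
      using i ps qs by (auto simp: nlists_def)
    then show ?thesis
      using H P front[of x] front[of e] e_closed by simp
  qed
  then show "x \<in> cancellable_set n A g e P"
    using H unfolding cancellable_set_def by blast
qed

text \<open>Associativity shifts the inner product from the first to the last outer position,
  leaving \<open>x\<close> as an outer argument.\<close>

lemma g_nested_first:
  assumes "x \<in> A" "ts \<in> nlists (n - 1) A" "qs \<in> nlists (n - 1) A"
  shows "g (g (x # ts) # qs) = g (x # butlast ts @ [g (last ts # qs)])"
proof -
  have len: "length ts = n - 1" "length qs = n - 1"
    using assms by (auto simp: nlists_def)
  obtain us t where ts: "ts = us @ [t]"
    using len n_ge_2 by (cases ts rule: rev_cases) auto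
  \<comment> \<open>In this form of \<open>n\<close>, simplification can evaluate the
    \<open>take\<close> and \<open>drop\<close> terms of \<open>g_assoc\<close>.\<close>
  have n: "n = Suc (Suc (length us))"
    using len ts n_ge_2 by simp
  have "x # ts @ qs \<in> nlists (2 * n - 1) A"
    using assms n_ge_2 by (auto simp: nlists_def)
  from g_assoc[OF this, of 0 "n - 1"] show ?thesis
    using len by (simp add: ts n)
qed

text \<open>Apply \<open>g_nested_first\<close> to expose \<open>s\<close>, cancel it there, and
  apply the same identity backwards with \<open>e\<close> in place of \<open>s\<close>.\<close>

lemma cancellable_set_replace_inner:
  assumes s: "s \<in> cancellable_set n A g e P"
    and ts: "ts \<in> nlists (n - 1) A" and qs: "qs \<in> nlists (n - 1) A"
    and P: "g (g (s # ts) # qs) \<in> P"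
  shows "g (g (e # ts) # qs) \<in> P"
proof -
  have len: "length ts = n - 1" "ts \<noteq> []"
    using ts n_ge_2 by (auto simp: nlists_def)
  have "last ts # qs \<in> nlists n A"
    using ts qs len n_ge_2 by (auto simp: nlists_def)
  then have "g (last ts # qs) \<in> A"
    by (rule g_closed)
  then have "butlast ts @ [g (last ts # qs)] \<in> nlists (n - 1) A"
    using ts len n_ge_2 by (auto simp: nlists_def dest: in_set_butlastD)
  then show ?thesis
    using s P g_nested_first[OF _ ts qs] e_closed by (simp add: cancellable_set_iff)
qed

text \<open>Here \<open>k\<close> counts the factors already replaced by \<open>e\<close>; it must
  be arbitrary in the induction, since it grows as \<open>ss\<close> shrinks.\<close>

lemma cancellable_set_replace_all:
  assumes "k + length ss = n" "set ss \<subseteq> cancellable_set n A g e P"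
    and "qs \<in> nlists (n - 1) A" "g (g (replicate k e @ ss) # qs) \<in> P"
  shows "g (e # qs) \<in> P"
  using assms
proof (induction ss arbitrary: k)
  case Nil
  have "replicate n e = e # replicate (n - 1) e"
    using n_ge_2 by (cases n) auto
  then have "g (replicate n e) = e"
    using g_one[OF e_closed] by simp
  with Nil show ?case by simp
next
  case (Cons s ss)
  have sub: "insert s (set ss) \<subseteq> A"
    using Cons.prems(2) by (auto simp: cancellable_set_def)
  \<comment> \<open>The next factor moves in front of the identities, where
    \<open>cancellable_set_replace_inner\<close> can act on it.\<close>
  have "g (replicate k e @ s # ss) = g (s # replicate k e @ ss)"
    by (rule g_perm) (use Cons.prems(1) sub e_closed in \<open>auto simp: nlists_def\<close>)
  moreover have "replicate k e @ ss \<in> nlists (n - 1) A"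
    using Cons.prems(1) sub e_closed by (auto simp: nlists_def)
  ultimately have "g (g (e # replicate k e @ ss) # qs) \<in> P"
    using Cons.prems by (intro cancellable_set_replace_inner[of s]) auto
  then show ?case
    using Cons.IH[of "Suc k"] Cons.prems by simp
qed

lemma multiplicative_subset_cancellable_set:
  "multiplicative_subset n A g (cancellable_set n A g e P)"
proof -
  \<comment> \<open>Non-emptiness: for \<open>x = e\<close> the defining implication is
    trivial.\<close>
  have "e \<in> cancellable_set n A g e P"
    by (simp add: cancellable_set_def e_closed)
  moreover have sub: "cancellable_set n A g e P \<subseteq> A"
    by (auto simp: cancellable_set_def)
  moreover have "g ss \<in> cancellable_set n A g e P"
    if "ss \<in> nlists n (cancellable_set n A g e P)" for ss
  proof -
    have ss: "length ss = n" "set ss \<subseteq> cancellable_set n A g e P"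
      using that by (auto simp: nlists_def)
    then have "g ss \<in> A"
      using sub by (intro g_closed) (auto simp: nlists_def)
    then show ?thesis
      using ss cancellable_set_replace_all[of 0 ss] by (simp add: cancellable_set_iff)
  qed
  ultimately show ?thesis
    unfolding multiplicative_subset_def by blast
qed

end

theorem theorem3p7:
  fixes m n :: nat
    and A :: "'a set"
    and f :: "'a list \<Rightarrow> 'a set"
    and g :: "'a list \<Rightarrow> 'a"
    and e :: 'a
    and P S :: "'a set"
  assumes "krasner_hyperring m n A f g e"
    and "proper_hyperideal m n A f g P"
    and "S = {x \<in> A. \<forall>i\<in>{1..n}. \<forall>ps\<in>nlists (i - 1) A. \<forall>qs\<in>nlists (n - i) A.
                g (ps @ x # qs) \<in> P \<longrightarrow> g (ps @ e # qs) \<in> P}"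
  shows "multiplicative_subset n A g S
    \<and> S_hyperideal m n A f g e S P
    \<and> (\<forall>S'. S \<subseteq> S' \<and> multiplicative_subset n A g S' \<and> S_hyperideal m n A f g e S' P
          \<longrightarrow> S' = S)"
proof -
  interpret krasner_hyperring m n A f g e by (fact assms(1))
  have S: "S = cancellable_set n A g e P"
    using assms(3) by (simp add: cancellable_set_def)
  have mult: "multiplicative_subset n A g S"
    unfolding S by (rule multiplicative_subset_cancellable_set)
  \<comment> \<open>Taking \<open>T = S\<close> gives the hyperideal property; taking
    \<open>T = S'\<close> gives the inclusion opposite to \<open>S \<subseteq> S'\<close>.\<close>
  have "S_hyperideal m n A f g e T P \<longleftrightarrow> T \<subseteq> S" if "multiplicative_subset n A g T" for T
    using that assms(2) S_hyperideal_iff_subset_cancellable_set[of T A]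
    by (auto simp: S multiplicative_subset_def)
  with mult show ?thesis by blast
qed

end
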